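(* Let $n$ be a natural number. The zero divisor graph $\Gamma[\mathbb{Z}_{p^n}]$ is not Eulerian, for any prime $p$.
   Context: For a commutative ring $R$ with unity, let $Z[R]$ be the set of its zero divisors. The zero divisor graph $\Gamma[R]$ is the undirected graph with vertex set $Z^*[R]=Z[R]\setminus\{0\}$ (the non-zero zero divisors of $R$), in which two distinct vertices $v,w$ are adjacent if $vw=0$. $\mathbb{Z}_m$ denotes the ring of integers modulo $m$. An Euler tour of a graph $G$ is a tour (closed walk) that includes each edge of $G$ exactly once. A graph $G$ is called an Euler graph (or Eulerian) if it has an Euler tour. *)

theory Defs
  imports "HOL-Number_Theory.Residues"
begin

definition zero_divisors :: "('a, 'b) ring_scheme \<Rightarrow> 'a set" where
  "zero_divisors R =
     {x \<in> carrier R. \<exists>y \<in> carrier R. y \<noteq> \<zero>\<^bsub>R\<^esub> \<and> x \<otimes>\<^bsub>R\<^esub> y = \<zero>\<^bsub>R\<^esub>}"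

(* A simple undirected graph: each edge is the two-element set of its endpoints. *)
record 'a ugraph =
  vertices :: "'a set"
  edges :: "'a set set"

definition zero_divisor_graph :: "('a, 'b) ring_scheme \<Rightarrow> 'a ugraph" where
  "zero_divisor_graph R =
     \<lparr> vertices = zero_divisors R - {\<zero>\<^bsub>R\<^esub>},
       edges = {{v, w} | v w. v \<in> zero_divisors R - {\<zero>\<^bsub>R\<^esub>} \<and> w \<in> zero_divisors R - {\<zero>\<^bsub>R\<^esub>} \<and>
                              v \<noteq> w \<and> v \<otimes>\<^bsub>R\<^esub> w = \<zero>\<^bsub>R\<^esub>} \<rparr>"

(* A walk is given by the list of vertices it visits; as the graph is simple, this
   determines the edges it traverses, one for each pair of consecutive vertices. *)
definition walk_edges :: "'a list \<Rightarrow> 'a set list" where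
  "walk_edges xs = map (\<lambda>(v, w). {v, w}) (zip xs (tl xs))"

definition is_walk :: "'a ugraph \<Rightarrow> 'a list \<Rightarrow> bool" where
  "is_walk G xs \<longleftrightarrow>
     xs \<noteq> [] \<and> set xs \<subseteq> vertices G \<and> set (walk_edges xs) \<subseteq> edges G"

(* The usual convention: a closed walk has positive length, so a single vertex on its
   own does not count as one. In particular an edgeless graph has no closed walk. *)
definition is_closed_walk :: "'a ugraph \<Rightarrow> 'a list \<Rightarrow> bool" where
  "is_closed_walk G xs \<longleftrightarrow> is_walk G xs \<and> length (walk_edges xs) > 0 \<and> hd xs = last xs"

definition is_Euler_tour :: "'a ugraph \<Rightarrow> 'a list \<Rightarrow> bool" where
  "is_Euler_tour G xs \<longleftrightarrow>
     is_closed_walk G xs \<and> (\<forall>e \<in> edges G. count_list (walk_edges xs) e = 1)"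

definition Eulerian :: "'a ugraph \<Rightarrow> bool" where
  "Eulerian G \<longleftrightarrow> (\<exists>xs. is_Euler_tour G xs)"

end

theory Submission
  imports Defs
begin

text \<open>
  Along an Euler tour every visit to a vertex \<open>v\<close> uses one edge to arrive and one to leave, so in an
  Eulerian graph every vertex has even degree (\<open>Eulerian_even_degree\<close>). Since a closed walk has
  positive length, there is also at least one edge. For each prime power \<open>p ^ n\<close> one of these two
  conditions fails.

  In the zero divisor graph of a commutative ring, the neighbours of \<open>v \<noteq> 0\<close> are just the nonzero
  elements of the annihilator of \<open>v\<close> other than \<open>v\<close> itself. Modulo \<open>p ^ n\<close> with \<open>n \<ge> 2\<close>, the
  annihilator of \<open>p ^ (n - 1)\<close> consists of the \<open>p ^ (n - 1)\<close> multiples of \<open>p\<close>, and removing \<open>0\<close> and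
  \<open>p ^ (n - 1)\<close> leaves \<open>p ^ (n - 1) - 2\<close> neighbours: an odd number when \<open>p\<close> is odd. For \<open>p = 2\<close> and
  \<open>n \<ge> 3\<close> the vertex \<open>2\<close> has the single neighbour \<open>2 ^ (n - 1)\<close>. Both are instances of
  \<open>Eulerian_zero_divisor_graph_residue_ring_parity\<close>, which treats the vertex \<open>d\<close> modulo \<open>d * k\<close>. The
  remaining graphs, those for \<open>n \<le> 1\<close> and for \<open>p ^ n = 4\<close>, have no edges.
\<close>

lemma walk_edges_Cons_Cons: "walk_edges (x # y # zs) = {x, y} # walk_edges (y # zs)"
  by (simp add: walk_edges_def)

text \<open>
  Each occurrence of \<open>v\<close> in a walk meets two of its edges, except that an occurrence at either end
  meets one fewer; the two indicator terms make up for this, and they are what the induction on the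
  walk needs. As there are no loops, no step of the walk joins two occurrences of \<open>v\<close>.
\<close>

lemma even_incident_walk_edges_plus_ends:
  assumes "xs \<noteq> []" and "\<forall>e \<in> set (walk_edges xs). card e = 2"
  shows "even (length (filter (\<lambda>e. v \<in> e) (walk_edges xs))
               + of_bool (hd xs = v) + of_bool (last xs = v))"
  using assms
proof (induction xs rule: induct_list012)
  case (3 x y zs)
  then have "x \<noteq> y" by (auto simp: walk_edges_Cons_Cons)
  with 3 show ?case by (auto simp: walk_edges_Cons_Cons)
qed (auto simp: walk_edges_def)

lemma distinct_if_count_list_eq_1:
  assumes "\<forall>x \<in> set xs. count_list xs x = 1"
  shows "distinct xs"
proof (rule ccontr)
  assume "\<not> distinct xs"
  then obtain as bs cs y where "xs = as @ [y] @ bs @ [y] @ cs"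
    using not_distinct_decomp by blast
  with assms show False by auto
qed

lemma Eulerian_even_degree:
  assumes "Eulerian G" and simple: "\<forall>e \<in> edges G. card e = 2"
  shows "even (card {e \<in> edges G. v \<in> e})"
proof -
  obtain xs where xs: "xs \<noteq> []" "set (walk_edges xs) \<subseteq> edges G" "hd xs = last xs"
    and once: "\<forall>e \<in> edges G. count_list (walk_edges xs) e = 1"
    using assms(1)
    by (auto simp: Eulerian_def is_Euler_tour_def is_closed_walk_def is_walk_def)
  have "edges G \<subseteq> set (walk_edges xs)"
    using once by (metis count_list_0_iff subsetI zero_neq_one)
  with xs(2) have edges: "set (walk_edges xs) = edges G" by blast
  have "distinct (walk_edges xs)"
    using once edges by (intro distinct_if_count_list_eq_1) simp
  then have "card {e \<in> edges G. v \<in> e} = length (filter (\<lambda>e. v \<in> e) (walk_edges xs))"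
    by (metis distinct_card distinct_filter edges set_filter)
  then show ?thesis
    using even_incident_walk_edges_plus_ends[of xs v] xs simple edges by auto
qed

lemma Eulerian_imp_edges_nonempty:
  assumes "Eulerian G"
  shows "edges G \<noteq> {}"
  using assms
  by (auto simp: Eulerian_def is_Euler_tour_def is_closed_walk_def is_walk_def)

text \<open>
  The set counted here is the neighbourhood of \<open>v\<close>, and its cardinality is the degree: if a nonzero \<open>w\<close>
  satisfies \<open>v \<otimes> w = \<zero>\<close>, then \<open>v\<close> and \<open>w\<close> witness for each other that they are zero divisors, so both
  are vertices of the graph.
\<close>

lemma (in cring) Eulerian_zero_divisor_graph_even_annihilator:
  assumes Euler: "Eulerian (zero_divisor_graph R)" and v: "v \<in> carrier R" "v \<noteq> \<zero>"
  shows "even (card ({w \<in> carrier R. v \<otimes> w = \<zero>} - {\<zero>, v}))"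
proof -
  let ?G = "zero_divisor_graph R" and ?N = "{w \<in> carrier R. v \<otimes> w = \<zero>} - {\<zero>, v}"
  have "{v, w} \<in> edges ?G" if "w \<in> ?N" for w
  proof -
    have "v \<in> zero_divisors R" "w \<in> zero_divisors R"
      using that v m_comm[of v w] unfolding zero_divisors_def by auto
    then show ?thesis
      using that v unfolding zero_divisor_graph_def by auto
  qed
  moreover have "\<exists>w \<in> ?N. e = {v, w}" if "e \<in> edges ?G" "v \<in> e" for e
  proof -
    from that obtain a b where ab: "e = {a, b}" "a \<in> carrier R" "b \<in> carrier R"
      "a \<noteq> \<zero>" "b \<noteq> \<zero>" "a \<noteq> b" "a \<otimes> b = \<zero>"
      by (auto simp: zero_divisor_graph_def zero_divisors_def)
    then consider "v = a" | "v = b" using \<open>v \<in> e\<close> by blast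
    then show ?thesis
    proof cases
      case 1 then show ?thesis using ab by auto
    next
      case 2 then show ?thesis using ab m_comm[of a b] by (intro bexI[of _ a]) auto
    qed
  qed
  ultimately have "{e \<in> edges ?G. v \<in> e} = (\<lambda>w. {v, w}) ` ?N"
    by auto
  moreover have "inj_on (\<lambda>w. {v, w}) ?N"
    by (auto simp: inj_on_def doubleton_eq_iff)
  ultimately have "card {e \<in> edges ?G. v \<in> e} = card ?N"
    by (simp add: card_image)
  moreover have "\<forall>e \<in> edges ?G. card e = 2"
    by (auto simp: zero_divisor_graph_def)
  ultimately show ?thesis
    using Eulerian_even_degree[OF Euler, of v] by simp
qed

lemma card_annihilator_residue_ring:
  fixes d k :: nat
  assumes "d > 0" "k > 0"
  shows "card {w \<in> carrier (residue_ring (int (d * k))).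
                int d \<otimes>\<^bsub>residue_ring (int (d * k))\<^esub> w = \<zero>\<^bsub>residue_ring (int (d * k))\<^esub>} = d"
proof -
  have "int d * w mod int (d * k) = 0 \<longleftrightarrow> int k dvd w" for w
    using assms by (simp add: mod_eq_0_iff_dvd)
  then have "{w \<in> carrier (residue_ring (int (d * k))).
                int d \<otimes>\<^bsub>residue_ring (int (d * k))\<^esub> w = \<zero>\<^bsub>residue_ring (int (d * k))\<^esub>}
             = {w \<in> {0..<int d * int k}. int k dvd w}"
    by (auto simp: residue_ring_def)
  also have "\<dots> = (\<lambda>j. int k * j) ` {0..<int d}"
    using assms by (auto simp: zero_le_mult_iff mult.commute elim!: dvdE)
  finally show ?thesis
    using assms by (simp add: card_image inj_on_def)
qed

text \<open>
  The degree condition at the vertex \<open>d\<close>. Its annihilator has \<open>d\<close> elements, among them \<open>0\<close>; it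
  contains \<open>d\<close> itself exactly when \<open>d * k\<close> divides \<open>d * d\<close>, that is, when \<open>k\<close> divides \<open>d\<close>.
\<close>

lemma Eulerian_zero_divisor_graph_residue_ring_parity:
  fixes d k :: nat
  assumes "d > 0" "k > 1" and Euler: "Eulerian (zero_divisor_graph (residue_ring (int (d * k))))"
  shows "odd d \<longleftrightarrow> \<not> k dvd d"
proof -
  let ?R = "residue_ring (int (d * k))"
  let ?A = "{w \<in> carrier ?R. int d \<otimes>\<^bsub>?R\<^esub> w = \<zero>\<^bsub>?R\<^esub>}"
  have "1 < d * k" using assms less_le_trans[of 1 k "d * k"] by simp
  then interpret R: residues "int (d * k)" ?R
    by unfold_locales (simp_all only: of_nat_1 flip: of_nat_less_iff)
  have "int d \<in> carrier ?R" "int d \<noteq> \<zero>\<^bsub>?R\<^esub>"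
    using assms by (simp_all add: residue_ring_def flip: of_nat_mult)
  then have even: "even (card (?A - {\<zero>\<^bsub>?R\<^esub>, int d}))"
    using R.Eulerian_zero_divisor_graph_even_annihilator[OF Euler, of "int d"] by simp
  have card: "card ?A = d"
    using assms by (intro card_annihilator_residue_ring) simp_all
  have zero: "\<zero>\<^bsub>?R\<^esub> \<in> ?A"
    using R.r_null \<open>int d \<in> carrier ?R\<close> by blast
  have self: "int d \<in> ?A \<longleftrightarrow> k dvd d"
  proof -
    have "int d \<in> ?A \<longleftrightarrow> int (d * d) mod int (d * k) = 0"
      using \<open>int d \<in> carrier ?R\<close> by (simp add: residue_ring_def)
    also have "\<dots> \<longleftrightarrow> k dvd d"
      using \<open>d > 0\<close> by (simp only: mod_eq_0_iff_dvd int_dvd_int_iff) simp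
    finally show ?thesis .
  qed
  have "card (?A - {\<zero>\<^bsub>?R\<^esub>, int d}) = d - 1 - of_bool (k dvd d)"
  proof -
    have "card (?A - {\<zero>\<^bsub>?R\<^esub>}) = d - 1"
      using card zero by (simp only: card_Diff_singleton)
    moreover have "?A - {\<zero>\<^bsub>?R\<^esub>, int d} = ?A - {\<zero>\<^bsub>?R\<^esub>} - {int d}"
      by blast
    moreover have "int d \<in> ?A - {\<zero>\<^bsub>?R\<^esub>} \<longleftrightarrow> k dvd d"
      using self \<open>int d \<noteq> \<zero>\<^bsub>?R\<^esub>\<close> by blast
    ultimately show ?thesis
      by (cases "k dvd d")
        (simp_all only: card_Diff_singleton_if if_True if_False of_bool_eq diff_zero)
  qed
  with even have "even (d - 1 - of_bool (k dvd d))" by simp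
  moreover have "d > 1" if "k dvd d"
    using dvd_imp_le[OF that] assms by simp
  ultimately show ?thesis
    using \<open>d > 0\<close> by (cases "k dvd d") auto
qed

lemma edges_zero_divisor_graph_eq_empty:
  assumes "\<And>v w. \<lbrakk>v \<in> carrier R; w \<in> carrier R; v \<noteq> \<zero>\<^bsub>R\<^esub>; w \<noteq> \<zero>\<^bsub>R\<^esub>; v \<otimes>\<^bsub>R\<^esub> w = \<zero>\<^bsub>R\<^esub>\<rbrakk>
                 \<Longrightarrow> v = w"
  shows "edges (zero_divisor_graph R) = {}"
proof -
  have "zero_divisors R \<subseteq> carrier R" by (auto simp: zero_divisors_def)
  with assms show ?thesis unfolding zero_divisor_graph_def by simp blast
qed

lemma edges_zero_divisor_graph_residue_ring_prime:
  fixes p :: nat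
  assumes "prime p"
  shows "edges (zero_divisor_graph (residue_ring (int p))) = {}"
proof (rule edges_zero_divisor_graph_eq_empty)
  fix v w
  assume "v \<in> carrier (residue_ring (int p))" "w \<in> carrier (residue_ring (int p))"
    and "v \<noteq> \<zero>\<^bsub>residue_ring (int p)\<^esub>" "w \<noteq> \<zero>\<^bsub>residue_ring (int p)\<^esub>"
    and "v \<otimes>\<^bsub>residue_ring (int p)\<^esub> w = \<zero>\<^bsub>residue_ring (int p)\<^esub>"
  then have "0 < v" "v < int p" "0 < w" "w < int p" "int p dvd v * w"
    by (auto simp: residue_ring_def)
  moreover from this have "int p dvd v \<or> int p dvd w"
    using assms by (simp add: prime_dvd_mult_iff)
  ultimately show "v = w"
    using zdvd_not_zless by blast
qed

lemma edges_zero_divisor_graph_residue_ring_1: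
  "edges (zero_divisor_graph (residue_ring 1)) = {}"
  by (rule edges_zero_divisor_graph_eq_empty) (simp add: residue_ring_def)

lemma edges_zero_divisor_graph_residue_ring_4:
  "edges (zero_divisor_graph (residue_ring 4)) = {}"
proof (rule edges_zero_divisor_graph_eq_empty)
  fix v w :: int
  assume "v \<in> carrier (residue_ring 4)" "w \<in> carrier (residue_ring 4)"
    and "v \<noteq> \<zero>\<^bsub>residue_ring 4\<^esub>" "w \<noteq> \<zero>\<^bsub>residue_ring 4\<^esub>"
    and "v \<otimes>\<^bsub>residue_ring 4\<^esub> w = \<zero>\<^bsub>residue_ring 4\<^esub>"
  then have "v \<in> {1, 2, 3}" "w \<in> {1, 2, 3}" "v * w mod 4 = 0"
    by (auto simp: residue_ring_def)
  then show "v = w" by auto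
qed

theorem theorem3p3:
  fixes n p :: nat
  assumes "prime p"
  shows "\<not> Eulerian (zero_divisor_graph (residue_ring (int (p ^ n))))"
proof
  assume Euler: "Eulerian (zero_divisor_graph (residue_ring (int (p ^ n))))"
  note edge = Eulerian_imp_edges_nonempty[OF Euler]
  have "p > 1" using assms by (rule prime_gt_1_nat)
  consider "n = 0" | "n = 1" | "n \<ge> 2" "odd p" | "n = 2" "p = 2" | "n \<ge> 3" "p = 2"
    using assms prime_odd_nat[of p] \<open>p > 1\<close> by fastforce
  then show False
  proof cases
    case 1
    then show False using edge edges_zero_divisor_graph_residue_ring_1 by simp
  next
    case 2
    then show False using edge edges_zero_divisor_graph_residue_ring_prime[OF assms] by simp
  next
    case 3
    then have "p ^ n = p ^ (n - 1) * p"
      by (simp flip: power_Suc2)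
    then have "odd (p ^ (n - 1)) \<longleftrightarrow> \<not> p dvd p ^ (n - 1)"
      using Euler \<open>p > 1\<close> by (intro Eulerian_zero_divisor_graph_residue_ring_parity) simp_all
    with 3 show False by simp
  next
    case 4
    then show False using edge edges_zero_divisor_graph_residue_ring_4 by simp
  next
    case 5
    then have "p ^ n = 2 * 2 ^ (n - 1)"
      by (simp flip: power_Suc)
    moreover have "(1 :: nat) < 2 ^ (n - 1)"
      using 5 by (intro one_less_power) simp_all
    ultimately have "odd (2 :: nat) \<longleftrightarrow> \<not> 2 ^ (n - 1) dvd (2 :: nat)"
      using Euler 5 by (intro Eulerian_zero_divisor_graph_residue_ring_parity) simp_all
    then have "(2 :: nat) ^ (n - 1) dvd 2 ^ 1" by simp
    with 5 show False by (simp only: dvd_power_iff_le)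
  qed
qed

end
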